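(* There is an algorithm that decides, for any hypersequent, whether or not it has a derivation in $\mathbf{HR}$.
   Context: Terms. Fix a countable set of variables $x,y,z,\dots$. Terms (in negation normal form) are generated by $A ::= x \mid \overline{x} \mid 0 \mid A+A \mid rA \mid A\sqcup A \mid A\sqcap A$, where $x$ is a variable, $\overline{x}$ is the corresponding negated variable, and $r\in\mathbb{R}_{>0}$. The negation $\overline{A}$ of a term is defined by $\overline{x}$ (for $x$), $\overline{\overline{x}}=x$, $\overline{0}=0$, $\overline{A+B}=\overline{A}+\overline{B}$, $\overline{rA}=r\overline{A}$, $\overline{A\sqcup B}=\overline{A}\sqcap\overline{B}$, $\overline{A\sqcap B}=\overline{A}\sqcup\overline{B}$. A weighted term is $r.A$ with $r\in\mathbb{R}_{>0}$; a sequent $\vdash\Gamma$ has $\Gamma$ a finite (possibly empty) multiset of weighted terms; a hypersequent is a nonempty finite multiset of sequents, written $\vdash\Gamma_1\mid\cdots\mid\vdash\Gamma_n$, and $G\mid\vdash\Gamma$ denotes $G$ with the sequent $\vdash\Gamma$ added. For a finite (possibly empty) sequence $\vec r=(r_1,\dots,r_n)$ of strictly positive reals, $\vec r.A$ is the multiset $r_1.A,\dots,r_n.A$, $\sum\vec r=r_1+\dots+r_n$, and $s\vec r=(sr_1,\dots,sr_n)$; $s.\Gamma$ multiplies every weight in $\Gamma$ by $s>0$. The calculus $\mathbf{HR}$ has the rules (vectors are finite sequences of strictly positive reals): INIT: $\vdash$ with no premises. W: from $G$ infer $G\mid\vdash\Gamma$. C: from $G\mid\vdash\Gamma\mid\vdash\Gamma$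 infer $G\mid\vdash\Gamma$. S: from $G\mid\vdash\Gamma_1,\Gamma_2$ infer $G\mid\vdash\Gamma_1\mid\vdash\Gamma_2$. M: from $G\mid\vdash\Gamma_1$ and $G\mid\vdash\Gamma_2$ infer $G\mid\vdash\Gamma_1,\Gamma_2$. T: for $r>0$, from $G\mid\vdash r.\Gamma$ infer $G\mid\vdash\Gamma$. ID: if $\sum\vec r=\sum\vec s$, from $G\mid\vdash\Gamma$ infer $G\mid\vdash\Gamma,\vec r.x,\vec s.\overline{x}$. 0: from $G\mid\vdash\Gamma$ infer $G\mid\vdash\Gamma,\vec r.0$. $+$: from $G\mid\vdash\Gamma,\vec r.A,\vec r.B$ infer $G\mid\vdash\Gamma,\vec r.(A+B)$. $\times$: from $G\mid\vdash\Gamma,(s\vec r).A$ infer $G\mid\vdash\Gamma,\vec r.(sA)$. $\sqcup$: from $G\mid\vdash\Gamma,\vec r.A\mid\vdash\Gamma,\vec r.B$ infer $G\mid\vdash\Gamma,\vec r.(A\sqcup B)$. $\sqcap$: from $G\mid\vdash\Gamma,\vec r.A$ and $G\mid\vdash\Gamma,\vec r.B$ infer $G\mid\vdash\Gamma,\vec r.(A\sqcap B)$. CAN: if $\sum\vec r=\sum\vec s$, from $G\mid\vdash\Gamma,\vec s.A,\vec r.\overline{A}$ infer $G\mid\vdash\Gamma$. A derivation is a finite tree of rule instances whose leaves are INIT. *)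

theory Defs
  imports Complex_Main "HOL-Library.Multiset"
begin

section \<open>Terms, sequents and hypersequents\<close>

typedef preal = "{r::real. 0 < r}" morphisms real_of_preal Abs_preal
  by (rule exI[of _ 1]) simp

setup_lifting type_definition_preal

instantiation preal :: times
begin
lift_definition times_preal :: "preal \<Rightarrow> preal \<Rightarrow> preal" is "(*)"
  by simp
instance ..
end

datatype rterm =
    Var nat
  | NegVar nat
  | Zero
  | Plus rterm rterm
  | Scale preal rterm
  | Join rterm rterm
  | Meet rterm rterm

primrec neg :: "rterm \<Rightarrow> rterm" where
  "neg (Var x) = NegVar x"
| "neg (NegVar x) = Var x"
| "neg Zero = Zero"
| "neg (Plus A B) = Plus (neg A) (neg B)"
| "neg (Scale r A) = Scale r (neg A)"
| "neg (Join A B) = Meet (neg A) (neg B)"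
| "neg (Meet A B) = Join (neg A) (neg B)"

type_synonym wterm = "preal \<times> rterm"
type_synonym sequent = "wterm multiset"

text \<open>A hypersequent is a \<^emph>\<open>nonempty\<close> multiset of sequents.  The type also contains the
  empty multiset, which may occur as the context \<open>G\<close> of a rule but is never derivable.\<close>

type_synonym hypersequent = "sequent multiset"

definition weighted :: "preal list \<Rightarrow> rterm \<Rightarrow> sequent" where
  "weighted rs A = mset (map (\<lambda>r. (r, A)) rs)"

definition total :: "preal list \<Rightarrow> real" where
  "total rs = sum_list (map real_of_preal rs)"

definition scale_sequent :: "preal \<Rightarrow> sequent \<Rightarrow> sequent" where
  "scale_sequent s \<Gamma> = image_mset (\<lambda>(r, A). (s * r, A)) \<Gamma>"


section \<open>The calculus HR\<close>

inductive HR :: "hypersequent \<Rightarrow> bool" where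
  INIT: "HR {#{#}#}"
| W: "HR G \<Longrightarrow> HR (add_mset \<Gamma> G)"
| C: "HR (add_mset \<Gamma> (add_mset \<Gamma> G)) \<Longrightarrow> HR (add_mset \<Gamma> G)"
| S: "HR (add_mset (\<Gamma>1 + \<Gamma>2) G) \<Longrightarrow> HR (add_mset \<Gamma>1 (add_mset \<Gamma>2 G))"
| M: "HR (add_mset \<Gamma>1 G) \<Longrightarrow> HR (add_mset \<Gamma>2 G) \<Longrightarrow> HR (add_mset (\<Gamma>1 + \<Gamma>2) G)"
| T: "HR (add_mset (scale_sequent r \<Gamma>) G) \<Longrightarrow> HR (add_mset \<Gamma> G)"
| ID: "total rs = total ss \<Longrightarrow> HR (add_mset \<Gamma> G) \<Longrightarrow>
    HR (add_mset (\<Gamma> + weighted rs (Var x) + weighted ss (NegVar x)) G)"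
| ZERO: "HR (add_mset \<Gamma> G) \<Longrightarrow> HR (add_mset (\<Gamma> + weighted rs Zero) G)"
| PLUS: "HR (add_mset (\<Gamma> + weighted rs A + weighted rs B) G) \<Longrightarrow>
    HR (add_mset (\<Gamma> + weighted rs (Plus A B)) G)"
| TIMES: "HR (add_mset (\<Gamma> + weighted (map ((*) s) rs) A) G) \<Longrightarrow>
    HR (add_mset (\<Gamma> + weighted rs (Scale s A)) G)"
| JOIN: "HR (add_mset (\<Gamma> + weighted rs A) (add_mset (\<Gamma> + weighted rs B) G)) \<Longrightarrow>
    HR (add_mset (\<Gamma> + weighted rs (Join A B)) G)"
| MEET: "HR (add_mset (\<Gamma> + weighted rs A) G) \<Longrightarrow> HR (add_mset (\<Gamma> + weighted rs B) G) \<Longrightarrow>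
    HR (add_mset (\<Gamma> + weighted rs (Meet A B)) G)"
| CAN: "total rs = total ss \<Longrightarrow> HR (add_mset (\<Gamma> + weighted ss A + weighted rs (neg A)) G) \<Longrightarrow>
    HR (add_mset \<Gamma> G)"


section \<open>Algorithms on exact real data\<close>

text \<open>The weights and scalars of a hypersequent are arbitrary reals, so an algorithm is understood
  in the exact real arithmetic (Blum--Shub--Smale, real RAM) sense: the atomic operations are the
  field operations and order comparison on reals.  Programs are finite lists of mutually recursive
  first-order functions over binary trees whose leaves carry reals.  The only real constants
  available to a program are 0 and 1.  This matters: an arbitrary real constant could store an
  undecidable set of natural numbers, whereas without such constants a computation stays in the
  field generated by its input (lemma \<open>eval_subfield\<close> below) and, on rational input, is an ordinary
  computation on finite data.\<close>

datatype data = Num real | Null | Cell data data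

datatype expr =
    Arg nat
  | Const0
  | Const1
  | Add expr expr
  | Sub expr expr
  | Mul expr expr
  | Div expr expr
  | IfLess expr expr expr expr
  | MkNull
  | MkCell expr expr
  | Left expr
  | Right expr
  | IfCell expr expr expr
  | Call nat "expr list"

type_synonym program = "expr list"

text \<open>\<open>eval P env e v\<close>: evaluation of \<open>e\<close>, whose arguments have the values \<open>env\<close>, terminates with
  value \<open>v\<close>.  \<open>Call f es\<close> evaluates the body \<open>P ! f\<close> on the values of \<open>es\<close>.  Ill-typed operations
  and division by zero have no value.\<close>

inductive eval :: "program \<Rightarrow> data list \<Rightarrow> expr \<Rightarrow> data \<Rightarrow> bool" for P :: program where
  Arg: "i < length env \<Longrightarrow> eval P env (Arg i) (env ! i)"
| Const0: "eval P env Const0 (Num 0)"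
| Const1: "eval P env Const1 (Num 1)"
| Add: "eval P env e1 (Num a) \<Longrightarrow> eval P env e2 (Num b) \<Longrightarrow> eval P env (Add e1 e2) (Num (a + b))"
| Sub: "eval P env e1 (Num a) \<Longrightarrow> eval P env e2 (Num b) \<Longrightarrow> eval P env (Sub e1 e2) (Num (a - b))"
| Mul: "eval P env e1 (Num a) \<Longrightarrow> eval P env e2 (Num b) \<Longrightarrow> eval P env (Mul e1 e2) (Num (a * b))"
| Div: "eval P env e1 (Num a) \<Longrightarrow> eval P env e2 (Num b) \<Longrightarrow> b \<noteq> 0 \<Longrightarrow>
    eval P env (Div e1 e2) (Num (a / b))"
| IfLess_True: "eval P env e1 (Num a) \<Longrightarrow> eval P env e2 (Num b) \<Longrightarrow> a < b \<Longrightarrow>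
    eval P env e3 v \<Longrightarrow> eval P env (IfLess e1 e2 e3 e4) v"
| IfLess_False: "eval P env e1 (Num a) \<Longrightarrow> eval P env e2 (Num b) \<Longrightarrow> \<not> a < b \<Longrightarrow>
    eval P env e4 v \<Longrightarrow> eval P env (IfLess e1 e2 e3 e4) v"
| MkNull: "eval P env MkNull Null"
| MkCell: "eval P env e1 u \<Longrightarrow> eval P env e2 v \<Longrightarrow> eval P env (MkCell e1 e2) (Cell u v)"
| Left: "eval P env e (Cell u v) \<Longrightarrow> eval P env (Left e) u"
| Right: "eval P env e (Cell u v) \<Longrightarrow> eval P env (Right e) v"
| IfCell_True: "eval P env e1 (Cell u w) \<Longrightarrow> eval P env e2 v \<Longrightarrow> eval P env (IfCell e1 e2 e3) v"
| IfCell_False: "eval P env e1 u \<Longrightarrow> (\<forall>a b. u \<noteq> Cell a b) \<Longrightarrow> eval P env e3 v \<Longrightarrow>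
    eval P env (IfCell e1 e2 e3) v"
| Call: "list_all2 (eval P env) es vs \<Longrightarrow> f < length P \<Longrightarrow> eval P vs (P ! f) v \<Longrightarrow>
    eval P env (Call f es) v"

text \<open>The first function of a program is its entry point.\<close>

definition computes :: "program \<Rightarrow> data \<Rightarrow> data \<Rightarrow> bool" where
  "computes P x y \<longleftrightarrow> P \<noteq> [] \<and> eval P [x] (P ! 0) y"

inductive_cases eval_elims:
  "eval P env (Arg i) v"
  "eval P env Const0 v"
  "eval P env Const1 v"
  "eval P env (Add e1 e2) v"
  "eval P env (Sub e1 e2) v"
  "eval P env (Mul e1 e2) v"
  "eval P env (Div e1 e2) v"
  "eval P env (IfLess e1 e2 e3 e4) v"
  "eval P env MkNull v"
  "eval P env (MkCell e1 e2) v"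
  "eval P env (Left e) v"
  "eval P env (Right e) v"
  "eval P env (IfCell e1 e2 e3) v"
  "eval P env (Call f es) v"

lemma list_all2_functional:
  "list_all2 (\<lambda>e v. Q e v \<and> (\<forall>w. Q e w \<longrightarrow> w = v)) es vs \<Longrightarrow> list_all2 Q es ws \<Longrightarrow> ws = vs"
  by (induction es vs arbitrary: ws rule: list_all2_induct) (auto simp: list_all2_Cons1)

lemma eval_deterministic: "eval P env e v \<Longrightarrow> eval P env e w \<Longrightarrow> w = v"
proof (induction arbitrary: w rule: eval.induct)
  case (Call env es vs f v)
  from Call.prems obtain ws where ws: "list_all2 (eval P env) es ws" "eval P ws (P ! f) w"
    by (elim eval_elims)
  have "ws = vs"
    using list_all2_functional[of "eval P env" es vs ws] Call.IH(1) ws(1)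
    by (auto elim!: list_all2_mono)
  with ws(2) Call.IH show ?case by blast
qed (erule eval_elims; blast)+

lemma computes_deterministic: "computes P x y \<Longrightarrow> computes P x z \<Longrightarrow> z = y"
  by (auto simp: computes_def dest: eval_deterministic)

primrec reals_of :: "data \<Rightarrow> real set" where
  "reals_of (Num a) = {a}"
| "reals_of Null = {}"
| "reals_of (Cell u v) = reals_of u \<union> reals_of v"

lemma eval_subfield:
  assumes K: "0 \<in> K" "1 \<in> K"
    "\<And>a b. a \<in> K \<Longrightarrow> b \<in> K \<Longrightarrow> a + b \<in> K \<and> a - b \<in> K \<and> a * b \<in> K \<and> a / b \<in> K"
  shows "eval P env e v \<Longrightarrow> (\<Union>u\<in>set env. reals_of u) \<subseteq> K \<Longrightarrow> reals_of v \<subseteq> K"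
proof (induction rule: eval.induct)
  case (Arg i env)
  then show ?case using nth_mem by blast
next
  case (Call env es vs f v)
  have "reals_of u \<subseteq> K" if "u \<in> set vs" for u
    using that Call.IH(1) Call.prems by (auto simp: list_all2_conv_all_nth in_set_conv_nth)
  then show ?case using Call.IH by blast
qed (use K in auto)


section \<open>Hypersequents as input data\<close>

fun encode_list :: "('a \<Rightarrow> data) \<Rightarrow> 'a list \<Rightarrow> data" where
  "encode_list f [] = Null"
| "encode_list f (x # xs) = Cell (f x) (encode_list f xs)"

primrec encode_term :: "rterm \<Rightarrow> data" where
  "encode_term (Var x) = Cell (Num 0) (Num (real x))"
| "encode_term (NegVar x) = Cell (Num 1) (Num (real x))"
| "encode_term Zero = Cell (Num 2) Null"
| "encode_term (Plus A B) = Cell (Num 3) (Cell (encode_term A) (encode_term B))"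
| "encode_term (Scale r A) = Cell (Num 4) (Cell (Num (real_of_preal r)) (encode_term A))"
| "encode_term (Join A B) = Cell (Num 5) (Cell (encode_term A) (encode_term B))"
| "encode_term (Meet A B) = Cell (Num 6) (Cell (encode_term A) (encode_term B))"

definition encode_wterm :: "wterm \<Rightarrow> data" where
  "encode_wterm = (\<lambda>(r, A). Cell (Num (real_of_preal r)) (encode_term A))"

text \<open>A hypersequent is presented to a program by listing its sequents, and the weighted terms of
  each sequent, in an arbitrary order.\<close>

definition encode_hyper :: "wterm list list \<Rightarrow> data" where
  "encode_hyper = encode_list (encode_list encode_wterm)"

definition lists_hyper :: "wterm list list \<Rightarrow> hypersequent \<Rightarrow> bool" where
  "lists_hyper xss H \<longleftrightarrow> mset (map mset xss) = H"

definition decides_hyper :: "program \<Rightarrow> (hypersequent \<Rightarrow> bool) \<Rightarrow> bool" where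
  "decides_hyper P Q \<longleftrightarrow>
    (\<forall>H xss. H \<noteq> {#} \<longrightarrow> lists_hyper xss H \<longrightarrow>
      computes P (encode_hyper xss) (if Q H then Num 1 else Num 0))"

end

theory Submission
  imports Defs
begin

text \<open>A hypersequent is derivable iff every real valuation of the variables makes one of its sequents
  nonnegative.  For completeness, the logical rules are semantically invertible, so only
  hypersequents of literals matter; a valid one has, by Gordan's alternative, a nontrivial
  nonnegative combination of its sequents in which all variables cancel, and this combination is
  turned into a derivation by C, S, T and ID.  Validity is decided by decomposing terms into linear
  forms with the same invertible rules and then eliminating the variables one at a time by
  Fourier--Motzkin, with field operations and comparisons only.\<close>

section \<open>Real semantics and soundness\<close>

primrec sem :: "(nat \<Rightarrow> real) \<Rightarrow> rterm \<Rightarrow> real" where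
  "sem \<rho> (Var x) = \<rho> x"
| "sem \<rho> (NegVar x) = - \<rho> x"
| "sem \<rho> Zero = 0"
| "sem \<rho> (Plus A B) = sem \<rho> A + sem \<rho> B"
| "sem \<rho> (Scale r A) = real_of_preal r * sem \<rho> A"
| "sem \<rho> (Join A B) = max (sem \<rho> A) (sem \<rho> B)"
| "sem \<rho> (Meet A B) = min (sem \<rho> A) (sem \<rho> B)"

definition sem_seq :: "(nat \<Rightarrow> real) \<Rightarrow> sequent \<Rightarrow> real" where
  "sem_seq \<rho> \<Gamma> = (\<Sum>(r, A)\<in>#\<Gamma>. real_of_preal r * sem \<rho> A)"

definition valid :: "hypersequent \<Rightarrow> bool" where
  "valid H \<longleftrightarrow> (\<forall>\<rho>. \<exists>\<Gamma>\<in>#H. 0 \<le> sem_seq \<rho> \<Gamma>)"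

lemma real_of_preal_pos [simp]: "0 < real_of_preal r"
  using real_of_preal by simp

lemma real_of_preal_times [simp]: "real_of_preal (r * s) = real_of_preal r * real_of_preal s"
  by transfer simp

lemma real_of_preal_Abs_preal [simp]: "0 < x \<Longrightarrow> real_of_preal (Abs_preal x) = x"
  by (simp add: Abs_preal_inverse)

lemma sem_neg [simp]: "sem \<rho> (neg A) = - sem \<rho> A"
  by (induction A) auto

lemma sem_seq_simps [simp]:
  "sem_seq \<rho> {#} = 0"
  "sem_seq \<rho> (add_mset (r, A) \<Gamma>) = real_of_preal r * sem \<rho> A + sem_seq \<rho> \<Gamma>"
  "sem_seq \<rho> (\<Gamma> + \<Delta>) = sem_seq \<rho> \<Gamma> + sem_seq \<rho> \<Delta>"
  by (simp_all add: sem_seq_def)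

lemma sem_seq_weighted [simp]: "sem_seq \<rho> (weighted rs A) = total rs * sem \<rho> A"
  by (induction rs) (auto simp: weighted_def total_def algebra_simps)

lemma sem_seq_scale [simp]: "sem_seq \<rho> (scale_sequent s \<Gamma>) = real_of_preal s * sem_seq \<rho> \<Gamma>"
  by (induction \<Gamma>) (auto simp: scale_sequent_def algebra_simps)

lemma total_nonneg [simp]: "0 \<le> total rs"
  by (auto simp: total_def less_imp_le intro!: sum_list_nonneg)

lemma total_scale [simp]: "total (map ((*) s) rs) = real_of_preal s * total rs"
  by (induction rs) (auto simp: total_def algebra_simps)

text \<open>With the valuation fixed, each rule passes a nonnegative sequent from premises to
  conclusion. For S, a nonnegative sum has a nonnegative summand; for M, the two sums add up; for ID
  and CAN, equal totals make the added terms cancel.\<close>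

lemma HR_sound:
  assumes "HR H"
  shows "valid H"
  unfolding valid_def
proof
  fix \<rho>
  from assms show "\<exists>\<Gamma>\<in>#H. 0 \<le> sem_seq \<rho> \<Gamma>"
  proof (induction rule: HR.induct)
    case (T r \<Gamma> G)
    have "0 \<le> real_of_preal r * sem_seq \<rho> \<Gamma> \<longleftrightarrow> 0 \<le> sem_seq \<rho> \<Gamma>"
      using real_of_preal_pos[of r] by (simp add: zero_le_mult_iff not_le[symmetric] less_imp_le)
    with T show ?case by simp
  next
    case (JOIN \<Gamma> rs A B G)
    have "total rs * sem \<rho> A \<le> total rs * max (sem \<rho> A) (sem \<rho> B)"
      "total rs * sem \<rho> B \<le> total rs * max (sem \<rho> A) (sem \<rho> B)"
      by (auto intro!: mult_left_mono)
    with JOIN show ?case by (auto intro: order_trans)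
  next
    case (MEET \<Gamma> rs A G B)
    then show ?case by (auto simp: min_def)
  qed (auto simp: algebra_simps)
qed

section \<open>Completeness\<close>

lemma separating_point:
  fixes L U :: "real set"
  assumes "finite L" "finite U" "\<forall>l\<in>L. \<forall>u\<in>U. l < u"
  shows "\<exists>x. (\<forall>l\<in>L. l < x) \<and> (\<forall>u\<in>U. x < u)"
proof (cases "L = {} \<or> U = {}")
  case True
  \<comment> \<open>Inserting 0 gives \<open>Max\<close> and \<open>Min\<close> a nonempty set. As
    one of L and U is empty, a single one of the two bounds already serves as x.\<close>
  obtain a where "\<forall>l\<in>insert 0 L. l < a"
    using assms(1) gt_ex[of "Max (insert 0 L)"] by (auto simp del: Max_insert)
  moreover obtain b where "\<forall>u\<in>insert 0 U. b < u"
    using assms(2) lt_ex[of "Min (insert 0 U)"] by (auto simp del: Min_insert)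
  ultimately show ?thesis using True by auto
next
  case False
  with assms have "Max L < Min U" by simp
  then obtain x where "Max L < x" "x < Min U" using dense by blast
  with assms False show ?thesis by auto
qed

text \<open>A constraint with positive \<open>c f\<close> bounds x from above by
  \<open>- p f / c f\<close>, one with negative \<open>c g\<close> bounds it from below by
  \<open>- p g / c g\<close>. The combination on the right compares these two bounds with
  denominators cleared. The lemma serves both Gordan's alternative and the correctness of the
  elimination procedure.\<close>

lemma fourier_motzkin:
  fixes c p :: "'a \<Rightarrow> real"
  assumes "finite F"
  shows "(\<exists>x. \<forall>f\<in>F. c f * x + p f < 0) \<longleftrightarrow>
    (\<forall>f\<in>F. c f = 0 \<longrightarrow> p f < 0) \<and>
    (\<forall>f\<in>F. \<forall>g\<in>F. 0 < c f \<longrightarrow> c g < 0 \<longrightarrow> - c g * p f + c f * p g < 0)"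
    (is "?L \<longleftrightarrow> ?R")
proof
  assume ?L
  then obtain x where x: "\<forall>f\<in>F. c f * x + p f < 0" by blast
  have "- c g * p f + c f * p g < 0" if "f \<in> F" "g \<in> F" "0 < c f" "c g < 0" for f g
  proof -
    have "- c g * (c f * x + p f) < 0" "c f * (c g * x + p g) < 0"
      by (rule mult_pos_neg; use that x in simp)+
    then show ?thesis by (simp add: algebra_simps)
  qed
  with x show ?R by fastforce
next
  assume R: ?R
  let ?lo = "(\<lambda>g. - p g / c g) ` {g \<in> F. c g < 0}"
  let ?hi = "(\<lambda>f. - p f / c f) ` {f \<in> F. 0 < c f}"
  have fin: "finite ?lo" "finite ?hi" using assms by auto
  have "\<forall>l\<in>?lo. \<forall>h\<in>?hi. l < h"
  proof safe
    fix f g assume fg: "f \<in> F" "0 < c f" "g \<in> F" "c g < 0"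
    with R have "- c g * p f + c f * p g < 0" by blast
    with fg show "- p g / c g < - p f / c f"
      by (simp add: divide_simps) (simp add: algebra_simps)
  qed
  then obtain x where x: "\<forall>l\<in>?lo. l < x" "\<forall>h\<in>?hi. x < h"
    using separating_point[OF fin] by blast
  have "c f * x + p f < 0" if f: "f \<in> F" for f
  proof (cases "c f" "0::real" rule: linorder_cases)
    case less
    with x f have "- p f / c f < x" by blast
    with less show ?thesis by (simp add: field_simps)
  next
    case equal
    with R f show ?thesis by simp
  next
    case greater
    with x f have "x < - p f / c f" by blast
    with greater show ?thesis by (simp add: field_simps)
  qed
  then show ?L by blast
qed

section \<open>Positive combinations of sequents and Gordan's alternative\<close>

inductive cone :: "sequent set \<Rightarrow> sequent \<Rightarrow> bool" for S where
  base: "\<Gamma> \<in> S \<Longrightarrow> cone S \<Gamma>"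
| comb: "cone S \<Gamma> \<Longrightarrow> cone S \<Delta> \<Longrightarrow> cone S (scale_sequent a \<Gamma> + scale_sequent b \<Delta>)"

text \<open>Read from premise to conclusion, S splits a combination, T strips the multipliers, and C
  absorbs each member of S into its copy in H.\<close>

lemma HR_cone:
  "cone S \<Gamma> \<Longrightarrow> S \<subseteq> set_mset H \<Longrightarrow> HR (add_mset \<Gamma> H) \<Longrightarrow> HR H"
proof (induction arbitrary: H rule: cone.induct)
  case (base \<Gamma>)
  then obtain G where "H = add_mset \<Gamma> G" by (metis insert_DiffM subsetD)
  with base.prems show ?case by (auto intro: HR.C)
next
  case (comb \<Gamma> \<Delta> a b)
  have "HR (add_mset \<Gamma> (add_mset (scale_sequent b \<Delta>) H))"
    using comb.prems by (blast intro: HR.S HR.T)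
  then have "HR (add_mset \<Delta> (add_mset \<Gamma> H))"
    by (metis HR.T add_mset_commute)
  then have "HR (add_mset \<Gamma> H)"
    \<comment> \<open>The hypothesis for \<Delta> is used with \<Gamma> added to the hypersequent,
      which is why H has to vary in the induction.\<close>
    by (rule comb.IH(2)[rotated]) (use comb.prems in auto)
  then show ?case using comb.IH(1) comb.prems by blast
qed

text \<open>For a sequent of literals, the value at the i-th unit valuation is the net weight of
  variable i.\<close>

abbreviation coef :: "sequent \<Rightarrow> nat \<Rightarrow> real" where
  "coef \<Gamma> i \<equiv> sem_seq (\<lambda>j. if j = i then 1 else 0) \<Gamma>"

text \<open>Variables are eliminated from the last one down. Multipliers in \<open>cone\<close> are
  strictly positive and there is no empty combination, so the sequent found is automatically a
  nontrivial combination.\<close>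

lemma gordan:
  assumes "finite S" and "\<And>\<rho>. \<exists>\<Gamma>\<in>S. 0 \<le> (\<Sum>i<n. coef \<Gamma> i * \<rho> i)"
  shows "\<exists>\<Gamma>. cone S \<Gamma> \<and> (\<forall>i<n. coef \<Gamma> i = 0)"
  using assms
proof (induction n arbitrary: S)
  case 0
  then show ?case by (auto intro: cone.base)
next
  case (Suc n)
  \<comment> \<open>The multipliers are chosen to cancel variable n. On the pairs that enter
    \<open>S'\<close> both are positive, so \<open>Abs_preal\<close> is applied within its
    domain.\<close>
  define mix where "mix = (\<lambda>(\<Gamma>, \<Delta>). scale_sequent (Abs_preal (- coef \<Delta> n)) \<Gamma> +
    scale_sequent (Abs_preal (coef \<Gamma> n)) \<Delta>)"
  define S' where "S' = {\<Gamma> \<in> S. coef \<Gamma> n = 0} \<union>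
    mix ` ({\<Gamma> \<in> S. 0 < coef \<Gamma> n} \<times> {\<Delta> \<in> S. coef \<Delta> n < 0})"
  have "finite S'" using Suc.prems(1) by (auto simp: S'_def)
  \<comment> \<open>A valuation making all of \<open>S'\<close> negative would, by
    \<open>fourier_motzkin\<close>, admit a new value x for variable n that makes all of S
    negative.\<close>
  moreover have "\<exists>\<Gamma>\<in>S'. 0 \<le> (\<Sum>i<n. coef \<Gamma> i * \<rho> i)" for \<rho>
  proof (rule ccontr)
    let ?p = "\<lambda>\<Gamma>. \<Sum>i<n. coef \<Gamma> i * \<rho> i"
    assume "\<not> (\<exists>\<Gamma>\<in>S'. 0 \<le> ?p \<Gamma>)"
    then have neg: "?p \<Gamma> < 0" if "\<Gamma> \<in> S'" for \<Gamma> using that by force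
    have "- coef \<Delta> n * ?p \<Gamma> + coef \<Gamma> n * ?p \<Delta> < 0"
      if "\<Gamma> \<in> S" "\<Delta> \<in> S" "0 < coef \<Gamma> n" "coef \<Delta> n < 0" for \<Gamma> \<Delta>
    proof -
      have "- coef \<Delta> n * ?p \<Gamma> + coef \<Gamma> n * ?p \<Delta> = ?p (mix (\<Gamma>, \<Delta>))"
        using that
        by (simp add: mix_def sum_distrib_left sum.distrib sum_subtractf sum_negf algebra_simps)
      also have "mix (\<Gamma>, \<Delta>) \<in> S'" using that by (auto simp: S'_def)
      then have "?p (mix (\<Gamma>, \<Delta>)) < 0" by (rule neg)
      finally show ?thesis .
    qed
    with neg have "\<exists>x. \<forall>\<Gamma>\<in>S. coef \<Gamma> n * x + ?p \<Gamma> < 0"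
      by (subst fourier_motzkin[OF Suc.prems(1)]) (auto simp: S'_def)
    then obtain x where "\<forall>\<Gamma>\<in>S. coef \<Gamma> n * x + ?p \<Gamma> < 0" by blast
    moreover obtain \<Gamma> where "\<Gamma> \<in> S" "0 \<le> (\<Sum>i<Suc n. coef \<Gamma> i * (\<rho>(n := x)) i)"
      using Suc.prems(2) by blast
    ultimately show False by (auto simp: algebra_simps not_le[symmetric])
  qed
  ultimately obtain \<Gamma> where \<Gamma>: "cone S' \<Gamma>" "\<forall>i<n. coef \<Gamma> i = 0"
    using Suc.IH by meson
  from \<Gamma>(1) have "cone S \<Gamma> \<and> coef \<Gamma> n = 0"
    by induction (auto simp: S'_def mix_def intro: cone.intros)
  with \<Gamma>(2) show ?case by (auto simp: less_Suc_eq)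
qed

section \<open>Derivability of valid hypersequents of literals\<close>

definition atomic :: "nat \<Rightarrow> sequent \<Rightarrow> bool" where
  "atomic n \<Gamma> \<longleftrightarrow> (\<forall>(r, A)\<in>#\<Gamma>. \<exists>x<n. A = Var x \<or> A = NegVar x)"

lemma atomic_simps [simp]:
  "atomic n {#}"
  "atomic n (add_mset (r, A) \<Gamma>) \<longleftrightarrow> (\<exists>x<n. A = Var x \<or> A = NegVar x) \<and> atomic n \<Gamma>"
  "atomic n (\<Gamma> + \<Delta>) \<longleftrightarrow> atomic n \<Gamma> \<and> atomic n \<Delta>"
  by (fastforce simp: atomic_def)+

lemma atomic_scale [simp]: "atomic n (scale_sequent s \<Gamma>) \<longleftrightarrow> atomic n \<Gamma>"
  by (auto simp: atomic_def scale_sequent_def)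

lemma sem_seq_atomic:
  "atomic n \<Gamma> \<Longrightarrow> sem_seq \<rho> \<Gamma> = (\<Sum>i<n. coef \<Gamma> i * \<rho> i)"
proof (induction \<Gamma>)
  case (add rA \<Gamma>)
  obtain r A where rA: "rA = (r, A)" by fastforce
  from add.prems rA obtain x where "x < n" "A = Var x \<or> A = NegVar x" by auto
  then have "sem \<rho> A = (\<Sum>i<n. sem (\<lambda>j. if j = i then 1 else 0) A * \<rho> i)"
    by (auto simp: sum_negf if_distrib[of uminus] if_distrib[of "\<lambda>c. c * _"] cong: if_cong)
  with add rA show ?case by (simp add: algebra_simps sum.distrib sum_distrib_left)
qed simp

text \<open>The rule ID speaks of lists of weights while a sequent is a multiset; this collects all
  occurrences of one term into such a list.\<close>

lemma weighted_filter:
  assumes "\<And>r B. (r, B) \<in># \<Gamma> \<Longrightarrow> P (r, B) \<longleftrightarrow> B = A"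
  shows "\<exists>rs. filter_mset P \<Gamma> = weighted rs A"
  using assms
proof (induction \<Gamma>)
  case empty
  show ?case by (rule exI[of _ "[]"]) (simp add: weighted_def)
next
  case (add rB \<Gamma>)
  then obtain rs where rs: "filter_mset P \<Gamma> = weighted rs A" by auto
  obtain r B where rB: "rB = (r, B)" by fastforce
  show ?case
  proof (cases "B = A")
    case True
    with add.prems rB rs show ?thesis
      by (intro exI[of _ "r # rs"]) (simp add: weighted_def)
  next
    case False
    with add.prems rB rs show ?thesis by auto
  qed
qed

text \<open>One application of ID per variable introduces all its occurrences at once, starting from
  the empty sequent of INIT.\<close>

lemma HR_zero_atomic:
  "atomic n \<Gamma> \<Longrightarrow> \<forall>i<n. coef \<Gamma> i = 0 \<Longrightarrow> HR {#\<Gamma>#}"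
proof (induction n arbitrary: \<Gamma>)
  case 0
  then have "\<Gamma> = {#}" by (cases \<Gamma>) (auto simp: atomic_def)
  then show ?case by (simp add: HR.INIT)
next
  case (Suc n)
  obtain rs where rs: "filter_mset (\<lambda>(_, B). B = Var n) \<Gamma> = weighted rs (Var n)"
    using weighted_filter[of \<Gamma> "\<lambda>(_, B). B = Var n" "Var n"] by auto
  obtain ss where ss: "filter_mset (\<lambda>(_, B). B = NegVar n) \<Gamma> = weighted ss (NegVar n)"
    using weighted_filter[of \<Gamma> "\<lambda>(_, B). B = NegVar n" "NegVar n"] by auto
  define \<Delta> where "\<Delta> = filter_mset (\<lambda>(_, B). B \<noteq> Var n \<and> B \<noteq> NegVar n) \<Gamma>"
  have \<Gamma>: "\<Gamma> = \<Delta> + weighted rs (Var n) + weighted ss (NegVar n)"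
    unfolding \<Delta>_def rs[symmetric] ss[symmetric]
    by (rule sym, induction \<Gamma>) auto
  have atomic: "atomic n \<Delta>"
    using Suc.prems(1) by (fastforce simp: \<Delta>_def atomic_def less_Suc_eq)
  \<comment> \<open>All variables of \<Delta> lie below n, so the coefficient of variable n in
    \<Gamma> is \<open>total rs - total ss\<close>; its vanishing is the side condition of
    ID.\<close>
  have "coef \<Delta> n = 0" by (subst sem_seq_atomic[OF atomic]) (auto intro!: sum.neutral)
  moreover have "coef \<Gamma> n = 0" using Suc.prems by simp
  ultimately have "total rs = total ss" unfolding \<Gamma> by simp
  moreover have "coef \<Delta> i = 0" if "i < n" for i
    using Suc.prems(2)[rule_format, of i] that unfolding \<Gamma> by simp
  ultimately show ?case using Suc.IH[OF atomic] unfolding \<Gamma> by (intro HR.ID) simp_all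
qed

lemma HR_W_many: "HR G \<Longrightarrow> HR (G + H)"
  by (induction H) (auto intro: HR.W)

text \<open>The cancelling combination from \<open>gordan\<close> is derivable on its own; H is
  added by weakening, and \<open>HR_cone\<close> then removes the combination.\<close>

lemma HR_complete_atomic:
  assumes "\<forall>\<Gamma>\<in>#H. atomic n \<Gamma>" "valid H"
  shows "HR H"
proof -
  have "\<exists>\<Gamma>\<in>set_mset H. 0 \<le> (\<Sum>i<n. coef \<Gamma> i * \<rho> i)" for \<rho>
  proof -
    from assms obtain \<Gamma> where \<Gamma>: "\<Gamma> \<in># H" "0 \<le> sem_seq \<rho> \<Gamma>" "atomic n \<Gamma>"
      by (auto simp: valid_def)
    note \<Gamma>(2)
    also have "sem_seq \<rho> \<Gamma> = (\<Sum>i<n. coef \<Gamma> i * \<rho> i)" by (rule sem_seq_atomic) fact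
    finally show ?thesis using \<Gamma>(1) by blast
  qed
  then obtain \<Gamma> where \<Gamma>: "cone (set_mset H) \<Gamma>" "\<forall>i<n. coef \<Gamma> i = 0"
    using gordan[of "set_mset H" n] by auto
  from \<Gamma>(1) have "atomic n \<Gamma>"
    by induction (use assms in auto)
  then have "HR ({#\<Gamma>#} + H)" using \<Gamma> by (blast intro: HR_zero_atomic HR_W_many)
  with HR_cone[OF \<Gamma>(1)] show ?thesis by simp
qed

section \<open>Reduction of arbitrary terms to literals\<close>

primrec nodes :: "rterm \<Rightarrow> nat" where
  "nodes (Var x) = 1"
| "nodes (NegVar x) = 1"
| "nodes Zero = 1"
| "nodes (Plus A B) = Suc (nodes A + nodes B)"
| "nodes (Scale r A) = Suc (nodes A)"
| "nodes (Join A B) = Suc (nodes A + nodes B)"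
| "nodes (Meet A B) = Suc (nodes A + nodes B)"

text \<open>Replacing a sequent by two copies that each lose a node lowers the sum of these weights.\<close>

definition complexity :: "sequent \<Rightarrow> nat" where
  "complexity \<Gamma> = 3 ^ (\<Sum>(r, A)\<in>#\<Gamma>. nodes A)"

lemma complexity_add [simp]: "complexity (add_mset (r, A) \<Gamma>) = 3 ^ nodes A * complexity \<Gamma>"
  by (simp add: complexity_def power_add)

lemma complexity_pos [simp]: "0 < complexity \<Gamma>"
  by (simp add: complexity_def)

lemma complexity_join:
  "(3::nat) ^ a * c + 3 ^ b * c < 3 * (3 ^ (a + b) * c)" if "0 < c"
proof -
  have "(3::nat) ^ a * c \<le> 3 ^ (a + b) * c" "3 ^ b * c \<le> 3 ^ (a + b) * c"
    by (simp_all add: power_add)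
  moreover have "0 < (3::nat) ^ (a + b) * c" using that by simp
  ultimately show ?thesis by linarith
qed

lemma three_power_less [simp]:
  "(3::nat) ^ a < 3 * 3 ^ (a + b)" "(3::nat) ^ b < 3 * 3 ^ (a + b)"
  using complexity_join[of 1 a b] by auto

text \<open>Induction on the total complexity: a compound term is decomposed by reading its rule
  upwards. Apart from Meet this does not change which valuations make some sequent nonnegative; for
  Meet, the minimum lies below both arguments, so both premises stay valid.\<close>

lemma HR_complete: "valid H \<Longrightarrow> HR H"
proof (induction "\<Sum>\<Gamma>\<in>#H. complexity \<Gamma>" arbitrary: H rule: less_induct)
  case less
  show ?case
  proof (cases "\<forall>\<Gamma>\<in>#H. \<forall>(r, A)\<in>#\<Gamma>. \<exists>x. A = Var x \<or> A = NegVar x")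
    case True
    \<comment> \<open>Only finitely many terms occur, so a single n bounds the variables of all
      sequents at once.\<close>
    define X where "X = (\<Union>\<Gamma>\<in>set_mset H. snd ` set_mset \<Gamma>)"
    have "finite (Var -` X \<union> NegVar -` X)"
      by (intro finite_UnI finite_vimageI) (auto simp: X_def inj_def)
    then obtain n where n: "\<And>x. Var x \<in> X \<or> NegVar x \<in> X \<Longrightarrow> x < n"
      by (auto simp: finite_nat_set_iff_bounded)
    have "atomic n \<Gamma>" if "\<Gamma> \<in># H" for \<Gamma>
      unfolding atomic_def
    proof safe
      fix r A assume A: "(r, A) \<in># \<Gamma>"
      with True that obtain x where x: "A = Var x \<or> A = NegVar x" by blast
      moreover have "A \<in> X" using that A by (force simp: X_def)
      ultimately show "\<exists>x<n. A = Var x \<or> A = NegVar x" using n by blast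
    qed
    then show ?thesis using HR_complete_atomic less.prems by blast
  next
    case False
    then obtain \<Gamma> r A where \<Gamma>: "\<Gamma> \<in># H" "(r, A) \<in># \<Gamma>"
      and A: "\<And>x. A \<noteq> Var x" "\<And>x. A \<noteq> NegVar x" by blast
    from \<Gamma> obtain G \<Delta> where "H = add_mset \<Gamma> G" "\<Gamma> = add_mset (r, A) \<Delta>"
      by (metis insert_DiffM)
    then have H: "H = add_mset (add_mset (r, A) \<Delta>) G" by simp
    \<comment> \<open>Rules are applied to one occurrence at a time, hence with one-element weight
      vectors.\<close>
    have w: "weighted [r] B = {#(r, B)#}" for B by (simp add: weighted_def)
    have r: "0 < real_of_preal r" by simp
    have IH: "valid K \<Longrightarrow> (\<Sum>\<Gamma>\<in>#K. complexity \<Gamma>) < (\<Sum>\<Gamma>\<in>#H. complexity \<Gamma>) \<Longrightarrow> HR K" for K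
      using less.hyps by blast
    show ?thesis
    proof (cases A)
      case Zero
      have "HR (add_mset \<Delta> G)"
        by (rule IH) (use less.prems in \<open>auto simp: H Zero valid_def\<close>)
      then show ?thesis using HR.ZERO[of \<Delta> G "[r]"] by (simp add: H Zero w)
    next
      case (Plus B C)
      have "HR (add_mset (\<Delta> + weighted [r] B + weighted [r] C) G)"
        by (rule IH) (use less.prems in \<open>auto simp: H Plus valid_def w algebra_simps power_add\<close>)
      then show ?thesis using HR.PLUS[of \<Delta> "[r]" B C G] by (simp add: H Plus w)
    next
      case (Scale s B)
      have "HR (add_mset (\<Delta> + weighted (map ((*) s) [r]) B) G)"
        by (rule IH) (use less.prems in \<open>auto simp: H Scale valid_def weighted_def algebra_simps\<close>)
      then show ?thesis using HR.TIMES[of \<Delta> s "[r]" B G] by (simp add: H Scale w)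
    next
      case (Join B C)
      have "HR (add_mset (\<Delta> + weighted [r] B) (add_mset (\<Delta> + weighted [r] C) G))"
        by (rule IH)
          (use less.prems complexity_join[of "complexity \<Delta>" "nodes B" "nodes C"] in
            \<open>auto simp: H Join valid_def w max_def algebra_simps power_add split: if_splits\<close>)
      then show ?thesis using HR.JOIN[of \<Delta> "[r]" B C G] by (simp add: H Join w)
    next
      case (Meet B C)
      have le: "real_of_preal r * min (sem \<rho> B) (sem \<rho> C) \<le> real_of_preal r * sem \<rho> B"
        "real_of_preal r * min (sem \<rho> B) (sem \<rho> C) \<le> real_of_preal r * sem \<rho> C" for \<rho>
        using r by (auto simp del: real_of_preal_pos)
      have valid: "valid (add_mset (\<Delta> + weighted [r] D) G)" if "D \<in> {B, C}" for D
        unfolding valid_def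
      proof
        fix \<rho>
        have "real_of_preal r * sem \<rho> A \<le> real_of_preal r * sem \<rho> D"
          using that le[of \<rho>] unfolding Meet by auto
        moreover have "(\<exists>\<Gamma>\<in>#G. 0 \<le> sem_seq \<rho> \<Gamma>) \<or>
            0 \<le> real_of_preal r * sem \<rho> A + sem_seq \<rho> \<Delta>"
          using less.prems by (auto simp: H valid_def)
        ultimately have "(\<exists>\<Gamma>\<in>#G. 0 \<le> sem_seq \<rho> \<Gamma>) \<or>
            0 \<le> real_of_preal r * sem \<rho> D + sem_seq \<rho> \<Delta>"
          by linarith
        then show "\<exists>\<Gamma>\<in>#add_mset (\<Delta> + weighted [r] D) G. 0 \<le> sem_seq \<rho> \<Gamma>"
          by (auto simp: w)
      qed
      have "HR (add_mset (\<Delta> + weighted [r] D) G)" if "D \<in> {B, C}" for D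
        by (rule IH[OF valid[OF that]]) (use that in \<open>auto simp: H Meet w\<close>)
      with HR.MEET[of \<Delta> "[r]" B G C] show ?thesis by (simp add: H Meet w)
    qed (use A in auto)
  qed
qed

lemma HR_iff_valid: "HR H \<longleftrightarrow> valid H"
  using HR_sound HR_complete by blast

section \<open>Fourier--Motzkin elimination on lists of coefficients\<close>

primrec lin :: "(nat \<Rightarrow> real) \<Rightarrow> real list \<Rightarrow> real" where
  "lin \<rho> [] = 0"
| "lin \<rho> (c # u) = c * \<rho> 0 + lin (\<lambda>i. \<rho> (Suc i)) u"

text \<open>Forms of different lengths are treated as padded with zeros; the default 0 fits
  \<open>tl [] = []\<close>.\<close>

definition hd0 :: "real list \<Rightarrow> real" where
  "hd0 u = (case u of [] \<Rightarrow> 0 | c # _ \<Rightarrow> c)"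

lemma hd0_simps [simp]: "hd0 [] = 0" "hd0 (c # u) = c"
  by (simp_all add: hd0_def)

fun mix :: "real \<Rightarrow> real \<Rightarrow> real list \<Rightarrow> real list \<Rightarrow> real list" where
  "mix a b (x # u) v = (a * x + b * hd0 v) # mix a b u (tl v)"
| "mix a b [] (y # v) = b * y # mix a b [] v"
| "mix a b [] [] = []"

fun pairs :: "real list \<Rightarrow> real list list \<Rightarrow> real list list \<Rightarrow> real list list" where
  "pairs u [] W = W"
| "pairs u (v # V) W = (if hd0 v < 0 then mix (- hd0 v) (hd0 u) (tl u) (tl v) # pairs u V W
     else pairs u V W)"

text \<open>U is traversed while V stays the full system, so that each positive leading coefficient
  meets every negative one. A form with negative leading coefficient contributes through these pairs
  alone. One round of elimination is \<open>elim U U\<close>.\<close>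

fun elim :: "real list list \<Rightarrow> real list list \<Rightarrow> real list list" where
  "elim [] V = []"
| "elim (u # U) V = (if hd0 u < 0 then elim U V
     else if 0 < hd0 u then pairs u V (elim U V) else tl u # elim U V)"

fun add_var :: "real \<Rightarrow> nat \<Rightarrow> real list \<Rightarrow> real list" where
  "add_var r 0 u = (hd0 u + r) # tl u"
| "add_var r (Suc x) u = hd0 u # add_var r x (tl u)"

lemma lin_hd0_tl: "lin \<rho> u = hd0 u * \<rho> 0 + lin (\<lambda>i. \<rho> (Suc i)) (tl u)"
  by (cases u) auto

lemma lin_mix [simp]: "lin \<rho> (mix a b u v) = a * lin \<rho> u + b * lin \<rho> v"
proof (induction a b u v arbitrary: \<rho> rule: mix.induct)
  case (1 a b x u v)
  then show ?case using lin_hd0_tl[of \<rho> v] by (simp add: algebra_simps)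
qed (auto simp: algebra_simps)

lemma lin_add_var [simp]: "lin \<rho> (add_var r x u) = lin \<rho> u + r * \<rho> x"
proof (induction r x u arbitrary: \<rho> rule: add_var.induct)
  case (1 r u)
  then show ?case using lin_hd0_tl[of \<rho> u] by (simp add: algebra_simps)
next
  case (2 r x u)
  then show ?case using lin_hd0_tl[of \<rho> u] by (simp add: algebra_simps)
qed

lemma length_mix [simp]: "length (mix a b u v) = max (length u) (length v)"
  by (induction a b u v rule: mix.induct) auto

lemma set_pairs [simp]: "set (pairs u V W) =
    (\<lambda>v. mix (- hd0 v) (hd0 u) (tl u) (tl v)) ` {v \<in> set V. hd0 v < 0} \<union> set W"
  by (induction V) auto

lemma set_elim: "set (elim U V) = tl ` {u \<in> set U. hd0 u = 0} \<union>
    (\<Union>u\<in>{u \<in> set U. 0 < hd0 u}.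
      (\<lambda>v. mix (- hd0 v) (hd0 u) (tl u) (tl v)) ` {v \<in> set V. hd0 v < 0})"
proof (induction U)
  case (Cons u U)
  then show ?case by (cases "hd0 u" "0::real" rule: linorder_cases) auto
qed simp

text \<open>A witness is a countermodel: it makes every sequent, given by its linear form,
  negative.\<close>

definition refutable :: "real list list \<Rightarrow> bool" where
  "refutable U \<longleftrightarrow> (\<exists>\<rho>. \<forall>u\<in>set U. lin \<rho> u < 0)"

lemma refutable_trivial: "\<forall>u\<in>set U. u = [] \<Longrightarrow> refutable U \<longleftrightarrow> U = []"
  by (cases U) (auto simp: refutable_def)

text \<open>This is \<open>fourier_motzkin\<close> with leading entries as coefficients of x and
  tails as remainders. Variable 0 disappears and the others are renumbered down by one.\<close>

lemma refutable_elim: "refutable (elim U U) \<longleftrightarrow> refutable U"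
proof -
  have "(\<forall>u\<in>set (elim U U). lin \<rho> u < 0) \<longleftrightarrow>
    (\<exists>x. \<forall>u\<in>set U. hd0 u * x + lin \<rho> (tl u) < 0)" for \<rho>
    unfolding fourier_motzkin[OF finite_set] set_elim
    by (simp add: ball_Un ball_UN algebra_simps) blast
  moreover have "(\<exists>\<rho> x. \<forall>u\<in>set U. hd0 u * x + lin \<rho> (tl u) < 0) \<longleftrightarrow> refutable U"
    unfolding refutable_def
  proof safe
    fix \<rho> x assume *: "\<forall>u\<in>set U. hd0 u * x + lin \<rho> (tl u) < 0"
    show "\<exists>\<rho>. \<forall>u\<in>set U. lin \<rho> u < 0"
      \<comment> \<open>The valuation is shifted up by one and x becomes the value of variable
        0.\<close>
      by (rule exI[of _ "case_nat x \<rho>"]) (use * in \<open>simp add: lin_hd0_tl[of "case_nat x \<rho>"]\<close>)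
  next
    fix \<rho> assume "\<forall>u\<in>set U. lin \<rho> u < 0"
    then show "\<exists>\<rho> x. \<forall>u\<in>set U. hd0 u * x + lin \<rho> (tl u) < 0"
      unfolding lin_hd0_tl[of \<rho>] by blast
  qed
  ultimately show ?thesis by (simp add: refutable_def)
qed

text \<open>This bounds the number of rounds: the system may gain forms, but the bound on their
  lengths drops.\<close>

lemma length_elim:
  assumes "\<forall>u\<in>set U. length u \<le> Suc n" "u \<in> set (elim U U)"
  shows "length u \<le> n"
  using assms by (fastforce simp: set_elim)

section \<open>The program\<close>

text \<open>In these bodies \<open>Call k\<close> refers to the \<open>k\<close>-th entry of the list \<open>prog\<close> below.\<close>

definition "main_body = Call 11 [Call 1 [Arg 0], MkNull]"

definition "init_body =
  IfCell (Arg 0) (MkCell (MkCell (Left (Arg 0)) MkNull) (Call 1 [Right (Arg 0)])) MkNull"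

definition "hd_body = IfCell (Arg 0) (Left (Arg 0)) Const0"

definition "tl_body = IfCell (Arg 0) (Right (Arg 0)) MkNull"

definition "mix_body =
  IfCell (Arg 2)
    (MkCell (Add (Mul (Arg 0) (Left (Arg 2))) (Mul (Arg 1) (Call 2 [Arg 3])))
      (Call 4 [Arg 0, Arg 1, Right (Arg 2), Call 3 [Arg 3]]))
    (IfCell (Arg 3)
      (MkCell (Mul (Arg 1) (Left (Arg 3))) (Call 4 [Arg 0, Arg 1, MkNull, Right (Arg 3)]))
      MkNull)"

definition "pairs_body =
  IfCell (Arg 1)
    (IfLess (Call 2 [Left (Arg 1)]) Const0
      (MkCell
        (Call 4 [Sub Const0 (Call 2 [Left (Arg 1)]), Call 2 [Arg 0],
          Call 3 [Arg 0], Call 3 [Left (Arg 1)]])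
        (Call 5 [Arg 0, Right (Arg 1), Arg 2]))
      (Call 5 [Arg 0, Right (Arg 1), Arg 2]))
    (Arg 2)"

definition "elim_body =
  IfCell (Arg 0)
    (IfLess (Call 2 [Left (Arg 0)]) Const0
      (Call 6 [Right (Arg 0), Arg 1])
      (IfLess Const0 (Call 2 [Left (Arg 0)])
        (Call 5 [Left (Arg 0), Arg 1, Call 6 [Right (Arg 0), Arg 1]])
        (MkCell (Call 3 [Left (Arg 0)]) (Call 6 [Right (Arg 0), Arg 1]))))
    MkNull"

definition "any_body =
  IfCell (Arg 0) (IfCell (Left (Arg 0)) Const1 (Call 7 [Right (Arg 0)])) Const0"

text \<open>The answer 1 means that no countermodel exists. Every valuation refutes the empty
  system, none refutes a nonempty system of empty forms, and any other system goes through a further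
  round.\<close>

definition "fm_body =
  IfCell (Arg 0) (IfLess Const0 (Call 7 [Arg 0]) (Call 8 [Call 6 [Arg 0, Arg 0]]) Const1) Const0"

definition "add_var_body =
  IfLess Const0 (Arg 1)
    (MkCell (Call 2 [Arg 2]) (Call 9 [Arg 0, Sub (Arg 1) Const1, Call 3 [Arg 2]]))
    (MkCell (Add (Call 2 [Arg 2]) (Arg 0)) (Call 3 [Arg 2]))"

text \<open>Programs have only the constants 0 and 1, so the constructor tags have to be built by
  addition.\<close>

primrec numeral_expr :: "nat \<Rightarrow> expr" where
  "numeral_expr 0 = Const0"
| "numeral_expr (Suc n) = Add (numeral_expr n) Const1"

text \<open>The arguments are the weight, the term, the remaining weighted terms and the linear form of
  the current sequent, followed by the other sequents and the linear forms already computed.\<close>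

definition "step_body =
  (let goal = (\<lambda>ts l. MkCell ts l);
    run = (\<lambda>todo. Call 11 [todo, Arg 5]);
    wt = (\<lambda>r A. MkCell r A);
    arg = Right (Arg 1)
  in
  IfLess (Left (Arg 1)) (numeral_expr 1)
    (run (MkCell (goal (Arg 2) (Call 9 [Arg 0, arg, Arg 3])) (Arg 4)))
  (IfLess (Left (Arg 1)) (numeral_expr 2)
    (run (MkCell (goal (Arg 2) (Call 9 [Sub Const0 (Arg 0), arg, Arg 3])) (Arg 4)))
  (IfLess (Left (Arg 1)) (numeral_expr 3)
    (run (MkCell (goal (Arg 2) (Arg 3)) (Arg 4)))
  (IfLess (Left (Arg 1)) (numeral_expr 4)
    (run (MkCell (goal (MkCell (wt (Arg 0) (Left arg)) (MkCell (wt (Arg 0) (Right arg)) (Arg 2)))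
      (Arg 3)) (Arg 4)))
  (IfLess (Left (Arg 1)) (numeral_expr 5)
    (run (MkCell (goal (MkCell (wt (Mul (Arg 0) (Left arg)) (Right arg)) (Arg 2)) (Arg 3)) (Arg 4)))
  (IfLess (Left (Arg 1)) (numeral_expr 6)
    (run (MkCell (goal (MkCell (wt (Arg 0) (Left arg)) (Arg 2)) (Arg 3))
      (MkCell (goal (MkCell (wt (Arg 0) (Right arg)) (Arg 2)) (Arg 3)) (Arg 4))))
  (IfLess Const0 (run (MkCell (goal (MkCell (wt (Arg 0) (Left arg)) (Arg 2)) (Arg 3)) (Arg 4)))
    (run (MkCell (goal (MkCell (wt (Arg 0) (Right arg)) (Arg 2)) (Arg 3)) (Arg 4)))
    Const0)))))))"

text \<open>A worklist: each goal holds the terms still to be decomposed and the linear form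
  collected so far. A goal without terms joins the finished forms, which are judged together once
  the worklist is empty.\<close>

definition "solve_body =
  IfCell (Arg 0)
    (IfCell (Left (Left (Arg 0)))
      (Call 10 [Left (Left (Left (Left (Arg 0)))), Right (Left (Left (Left (Arg 0)))),
        Right (Left (Left (Arg 0))), Right (Left (Arg 0)), Right (Arg 0), Arg 1])
      (Call 11 [Right (Arg 0), MkCell (Right (Left (Arg 0))) (Arg 1)]))
    (Call 8 [Arg 1])"

definition prog :: program where
  "prog = [main_body, init_body, hd_body, tl_body, mix_body, pairs_body, elim_body, any_body,
    fm_body, add_var_body, step_body, solve_body]"

lemma prog_simps [simp]:
  "prog \<noteq> []" "length prog = 12" "prog ! 0 = main_body" "prog ! 1 = init_body"
  "prog ! Suc 0 = init_body"
  "prog ! 2 = hd_body" "prog ! 3 = tl_body" "prog ! 4 = mix_body" "prog ! 5 = pairs_body"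
  "prog ! 6 = elim_body" "prog ! 7 = any_body" "prog ! 8 = fm_body" "prog ! 9 = add_var_body"
  "prog ! 10 = step_body" "prog ! 11 = solve_body"
  by (simp_all add: prog_def)

section \<open>Evaluation of the auxiliary functions\<close>

lemma eval_simps [simp]:
  "eval P env (Arg i) v \<longleftrightarrow> i < length env \<and> v = env ! i"
  "eval P env Const0 v \<longleftrightarrow> v = Num 0"
  "eval P env Const1 v \<longleftrightarrow> v = Num 1"
  "eval P env (Add e1 e2) v \<longleftrightarrow>
    (\<exists>a b. eval P env e1 (Num a) \<and> eval P env e2 (Num b) \<and> v = Num (a + b))"
  "eval P env (Sub e1 e2) v \<longleftrightarrow>
    (\<exists>a b. eval P env e1 (Num a) \<and> eval P env e2 (Num b) \<and> v = Num (a - b))"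
  "eval P env (Mul e1 e2) v \<longleftrightarrow>
    (\<exists>a b. eval P env e1 (Num a) \<and> eval P env e2 (Num b) \<and> v = Num (a * b))"
  "eval P env (IfLess e1 e2 e3 e4) v \<longleftrightarrow>
    (\<exists>a b. eval P env e1 (Num a) \<and> eval P env e2 (Num b) \<and>
      eval P env (if a < b then e3 else e4) v)"
  "eval P env MkNull v \<longleftrightarrow> v = Null"
  "eval P env (MkCell e1 e2) v \<longleftrightarrow>
    (\<exists>a b. eval P env e1 a \<and> eval P env e2 b \<and> v = Cell a b)"
  "eval P env (Left e) v \<longleftrightarrow> (\<exists>w. eval P env e (Cell v w))"
  "eval P env (Right e) v \<longleftrightarrow> (\<exists>u. eval P env e (Cell u v))"
  "eval P env (IfCell e1 e2 e3) v \<longleftrightarrow>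
    (\<exists>u. eval P env e1 u \<and> eval P env (if \<exists>a b. u = Cell a b then e2 else e3) v)"
  "eval P env (Call f es) v \<longleftrightarrow>
    (\<exists>vs. list_all2 (eval P env) es vs \<and> f < length P \<and> eval P vs (P ! f) v)"
  by (rule iffI; (erule eval_elims; fastforce)?; force intro: eval.intros split: if_splits)+

declare list_all2_Cons1 [simp]

abbreviation encode_form :: "real list \<Rightarrow> data" where
  "encode_form \<equiv> encode_list Num"

abbreviation encode_forms :: "real list list \<Rightarrow> data" where
  "encode_forms \<equiv> encode_list encode_form"

abbreviation encode_goal :: "wterm list \<times> real list \<Rightarrow> data" where
  "encode_goal \<equiv> \<lambda>(ts, l). Cell (encode_list encode_wterm ts) (encode_form l)"

lemma encode_list_eq_Cell [simp]: "(\<exists>a b. encode_list f xs = Cell a b) \<longleftrightarrow> xs \<noteq> []"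
  by (cases xs) auto

lemma encode_wterm_Pair [simp]:
  "encode_wterm (r, A) = Cell (Num (real_of_preal r)) (encode_term A)"
  by (simp add: encode_wterm_def)

lemma eval_hd [simp]:
  "eval prog [encode_form u] hd_body v \<longleftrightarrow> v = Num (hd0 u)"
  by (cases u) (auto simp: hd_body_def)

lemma eval_tl [simp]:
  "eval prog [encode_form u] tl_body v \<longleftrightarrow> v = encode_form (tl u)"
  by (cases u) (auto simp: tl_body_def)

lemma eval_mix [simp]:
  "eval prog [Num a, Num b, encode_form u, encode_form v] mix_body w \<longleftrightarrow>
    w = encode_form (mix a b u v)"
proof (induction a b u v arbitrary: w rule: mix.induct)
  case (2 a b y v)
  \<comment> \<open>The recursive call passes \<open>MkNull\<close>, so the induction hypothesis
    must show \<open>Null\<close> in place of the encoded empty list.\<close>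
  from 2[unfolded encode_list.simps] show ?case by (subst mix_body_def) simp
next
  case 3
  show ?case by (subst mix_body_def) simp
qed (subst mix_body_def, simp)

lemma eval_pairs [simp]:
  "eval prog [encode_form u, encode_forms V, encode_forms W] pairs_body w \<longleftrightarrow>
    w = encode_forms (pairs u V W)"
  by (induction V arbitrary: w) (subst pairs_body_def, simp)+

lemma eval_elim [simp]:
  "eval prog [encode_forms U, encode_forms V] elim_body w \<longleftrightarrow> w = encode_forms (elim U V)"
  by (induction U arbitrary: w) (subst elim_body_def, simp)+

lemma eval_any [simp]:
  "eval prog [encode_forms U] any_body w \<longleftrightarrow> w = Num (if \<exists>u\<in>set U. u \<noteq> [] then 1 else 0)"
proof (induction U arbitrary: w)
  case (Cons u U)
  then show ?case by (subst any_body_def, cases u) simp_all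
qed (subst any_body_def, simp)

lemma eval_add_var [simp]:
  "eval prog [Num r, Num (real x), encode_form u] add_var_body w \<longleftrightarrow> w = encode_form (add_var r x u)"
  by (induction r x u arbitrary: w rule: add_var.induct) (subst add_var_body_def, simp)+

lemma eval_init [simp]:
  "eval prog [encode_hyper xss] init_body w \<longleftrightarrow>
    w = encode_list encode_goal (map (\<lambda>ts. (ts, [])) xss)"
  by (induction xss arbitrary: w) (subst init_body_def, simp add: encode_hyper_def)+

text \<open>The recursion is not structural in U; the induction is on a bound for the lengths of the
  forms, which \<open>length_elim\<close> lowers in each round.\<close>

lemma eval_fm [simp]:
  "eval prog [encode_forms U] fm_body w \<longleftrightarrow> w = Num (if refutable U then 0 else 1)"
proof -
  have "\<forall>u\<in>set U. length u \<le> n \<Longrightarrow>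
    eval prog [encode_forms U] fm_body w \<longleftrightarrow> w = Num (if refutable U then 0 else 1)" for n
  proof (induction n arbitrary: U w)
    case 0
    then show ?case by (subst fm_body_def) (auto simp: refutable_trivial)
  next
    case (Suc n)
    then have "length u \<le> n" if "u \<in> set (elim U U)" for u
      using that length_elim by blast
    with Suc.IH[of "elim U U"] show ?case
      by (subst fm_body_def) (auto simp: refutable_elim refutable_trivial)
  qed
  \<comment> \<open>For empty U this maximum is unspecified, but then the length condition is
    vacuous.\<close>
  from this[of "Max (set (map length U))"] show ?thesis by simp
qed

section \<open>Correctness of the worklist\<close>

lemma eval_numeral_expr [simp]: "eval P env (numeral_expr n) v \<longleftrightarrow> v = Num (real n)"
  by (induction n arbitrary: v) (auto simp: algebra_simps)

text \<open>The tag comparisons are settled here once, leaving \<open>eval_solve\<close> with one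
  equivalence per constructor. For Meet, c is the answer for the first argument, and the second is
  run only if c is positive.\<close>

lemma eval_step:
  fixes ts rest U :: data and r :: real and l :: "real list"
  defines "step \<equiv> \<lambda>A. eval prog
    [Num r, encode_term A, ts, encode_form l, rest, U] step_body"
    and "solve \<equiv> \<lambda>todo. eval prog [todo, U] solve_body"
  shows
    "step (Var x) w \<longleftrightarrow> solve (Cell (Cell ts (encode_form (add_var r x l))) rest) w"
    "step (NegVar x) w \<longleftrightarrow> solve (Cell (Cell ts (encode_form (add_var (- r) x l))) rest) w"
    "step Zero w \<longleftrightarrow> solve (Cell (Cell ts (encode_form l)) rest) w"
    "step (Plus A B) w \<longleftrightarrow>
      solve (Cell (Cell (Cell (Cell (Num r) (encode_term A)) (Cell (Cell (Num r) (encode_term B)) ts))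
        (encode_form l)) rest) w"
    "step (Scale s A) w \<longleftrightarrow>
      solve (Cell (Cell (Cell (Cell (Num (r * real_of_preal s)) (encode_term A)) ts)
        (encode_form l)) rest) w"
    "step (Join A B) w \<longleftrightarrow>
      solve (Cell (Cell (Cell (Cell (Num r) (encode_term A)) ts) (encode_form l))
        (Cell (Cell (Cell (Cell (Num r) (encode_term B)) ts) (encode_form l)) rest)) w"
    "step (Meet A B) w \<longleftrightarrow> (\<exists>c.
      solve (Cell (Cell (Cell (Cell (Num r) (encode_term A)) ts) (encode_form l)) rest) (Num c) \<and>
      (if 0 < c
       then solve (Cell (Cell (Cell (Cell (Num r) (encode_term B)) ts) (encode_form l)) rest) w
       else w = Num 0))"
  unfolding step_def solve_def step_body_def Let_def
  by (simp_all del: numeral_expr.simps One_nat_def)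

text \<open>The invariant of the worklist: on the initial goals it is validity of the hypersequent,
  on the empty worklist it is the absence of a countermodel to the finished forms.\<close>

definition goals_valid :: "(wterm list \<times> real list) list \<Rightarrow> real list list \<Rightarrow> bool" where
  "goals_valid todo U \<longleftrightarrow> (\<forall>\<rho>. (\<exists>(ts, l)\<in>set todo. 0 \<le> sem_seq \<rho> (mset ts) + lin \<rho> l) \<or>
    (\<exists>u\<in>set U. 0 \<le> lin \<rho> u))"

lemma goals_valid_Nil: "goals_valid [] U \<longleftrightarrow> \<not> refutable U"
  by (simp add: goals_valid_def refutable_def not_less)

lemma goals_valid_simps:
  "goals_valid (([], l) # todo) U \<longleftrightarrow> goals_valid todo (l # U)"
  "goals_valid (((r, Var x) # ts, l) # todo) U \<longleftrightarrow>
    goals_valid ((ts, add_var (real_of_preal r) x l) # todo) U"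
  "goals_valid (((r, NegVar x) # ts, l) # todo) U \<longleftrightarrow>
    goals_valid ((ts, add_var (- real_of_preal r) x l) # todo) U"
  "goals_valid (((r, Zero) # ts, l) # todo) U \<longleftrightarrow> goals_valid ((ts, l) # todo) U"
  "goals_valid (((r, Plus A B) # ts, l) # todo) U \<longleftrightarrow>
    goals_valid (((r, A) # (r, B) # ts, l) # todo) U"
  "goals_valid (((r, Scale s A) # ts, l) # todo) U \<longleftrightarrow>
    goals_valid (((r * s, A) # ts, l) # todo) U"
  by (auto simp: goals_valid_def algebra_simps)

text \<open>At each valuation the goal becomes a conjunction inside a disjunction, and the
  disjunction distributes over it. So the arguments can be decided in two separate runs, unlike
  those of Join, which must share one worklist.\<close>

lemma goals_valid_meet:
  "goals_valid (((r, Meet A B) # ts, l) # todo) U \<longleftrightarrow>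
    goals_valid (((r, A) # ts, l) # todo) U \<and> goals_valid (((r, B) # ts, l) # todo) U"
proof -
  have min: "real_of_preal r * min a b = min (real_of_preal r * a) (real_of_preal r * b)" for a b
    by (simp add: min_mult_distrib_left less_imp_le)
  have "0 \<le> real_of_preal r * min a b + x \<longleftrightarrow>
      0 \<le> real_of_preal r * a + x \<and> 0 \<le> real_of_preal r * b + x" for a b x
    unfolding min by linarith
  then show ?thesis
    unfolding goals_valid_def by (auto simp: add.assoc)
qed

lemma goals_valid_join:
  "goals_valid (((r, Join A B) # ts, l) # todo) U \<longleftrightarrow>
    goals_valid (((r, A) # ts, l) # ((r, B) # ts, l) # todo) U"
proof -
  have max: "real_of_preal r * max a b = max (real_of_preal r * a) (real_of_preal r * b)" for a b
    by (simp add: max_mult_distrib_left less_imp_le)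
  have "0 \<le> real_of_preal r * max a b + x \<longleftrightarrow>
      0 \<le> real_of_preal r * a + x \<or> 0 \<le> real_of_preal r * b + x" for a b x
    unfolding max by linarith
  then show ?thesis
    unfolding goals_valid_def by (auto simp: add.assoc)
qed

text \<open>Induction on the summed complexity of the unfinished goals. The equivalence covers
  termination too, since it asserts that a value exists.\<close>

lemma eval_solve:
  "eval prog [encode_list encode_goal todo, encode_forms U] solve_body w \<longleftrightarrow>
    w = Num (if goals_valid todo U then 1 else 0)"
proof (induction "\<Sum>(ts, l)\<leftarrow>todo. complexity (mset ts)" arbitrary: todo U w rule: less_induct)
  case less
  show ?case
  proof (cases todo)
    case Nil
    then show ?thesis
      by (subst solve_body_def) (simp add: goals_valid_Nil)
  next
    case (Cons g rest)
    obtain ts l where g: "g = (ts, l)" by fastforce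
    note IH = less.hyps[unfolded Cons g]
    show ?thesis
    proof (cases ts)
      case Nil
      then show ?thesis
        \<comment> \<open>Even a goal without terms has complexity 1, so moving its form to the
          finished ones lowers the measure.\<close>
        using IH[of rest "l # U"] by (subst solve_body_def) (simp add: Cons g goals_valid_simps)
    next
      case (Cons rA ts')
      obtain r A where rA: "rA = (r, A)" by fastforce
      have todo: "todo = ((r, A) # ts', l) # rest"
        using \<open>todo = _\<close> g Cons rA by simp
      have IH: "(\<Sum>(ts, l)\<leftarrow>todo'. complexity (mset ts)) <
          3 ^ nodes A * complexity (mset ts') + (\<Sum>(ts, l)\<leftarrow>rest. complexity (mset ts)) \<Longrightarrow>
          eval prog [encode_list encode_goal todo', encode_forms U] solve_body w \<longleftrightarrow>
          w = Num (if goals_valid todo' U then 1 else 0)" for todo' w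
        using less.hyps[of todo'] by (simp add: todo)
      have "eval prog [encode_list encode_goal todo, encode_forms U] solve_body w \<longleftrightarrow>
        eval prog [Num (real_of_preal r), encode_term A, encode_list encode_wterm ts',
          encode_form l, encode_list encode_goal rest, encode_forms U] step_body w"
        by (subst solve_body_def) (simp add: todo)
      also have "\<dots> \<longleftrightarrow> w = Num (if goals_valid todo U then 1 else 0)"
      proof (cases A)
        case (Var x)
        then show ?thesis
          using IH[of "(ts', add_var (real_of_preal r) x l) # rest"]
          by (simp add: eval_step todo goals_valid_simps algebra_simps del: encode_term.simps)
      next
        case (NegVar x)
        then show ?thesis
          using IH[of "(ts', add_var (- real_of_preal r) x l) # rest"]
          by (simp add: eval_step todo goals_valid_simps algebra_simps del: encode_term.simps)
      next
        case Zero
        then show ?thesis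
          using IH[of "(ts', l) # rest"]
          by (simp add: eval_step todo goals_valid_simps del: encode_term.simps)
      next
        case (Plus B C)
        then show ?thesis
          using IH[of "((r, B) # (r, C) # ts', l) # rest"]
          by (simp add: eval_step todo goals_valid_simps algebra_simps power_add del: encode_term.simps)
      next
        case (Scale s B)
        then show ?thesis
          using IH[of "((r * s, B) # ts', l) # rest"]
          by (simp add: eval_step todo goals_valid_simps algebra_simps del: encode_term.simps)
      next
        case (Join B C)
        then show ?thesis
          using IH[of "((r, B) # ts', l) # ((r, C) # ts', l) # rest"]
            complexity_join[of "complexity (mset ts')" "nodes B" "nodes C"]
          by (simp add: eval_step todo goals_valid_join mult.assoc del: encode_term.simps)
      next
        case (Meet B C)
        then show ?thesis
          using IH[of "((r, B) # ts', l) # rest"] IH[of "((r, C) # ts', l) # rest"]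
          by (auto simp add: eval_step todo goals_valid_meet mult.assoc simp del: encode_term.simps)
      qed
      finally show ?thesis .
    qed
  qed
qed

lemma goals_valid_init:
  "goals_valid (map (\<lambda>ts. (ts, [])) xss) [] \<longleftrightarrow> valid (mset (map mset xss))"
  by (auto simp: goals_valid_def valid_def)

theorem theorem3p17:
  shows "\<exists>P :: program. decides_hyper P HR"
proof
  \<comment> \<open>The order of listing is immaterial, because \<open>goals_valid_init\<close>
    expresses the answer through the multiset that is listed.\<close>
  have "computes prog (encode_hyper xss) (if HR (mset (map mset xss)) then Num 1 else Num 0)"
    for xss
    using eval_solve[of "map (\<lambda>ts. (ts, [])) xss" "[]"]
    by (simp add: computes_def main_body_def goals_valid_init HR_iff_valid)
  then show "decides_hyper prog HR"
    unfolding decides_hyper_def lists_hyper_def by blast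
qed

end
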